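(* Let $f\in L^2(Q,\mathbb{R})$ and $w\in S^\infty(Q,(0,\infty))$, and write $f^*:=p_\sigma^w(f)$. Let $\Phi:I\to\mathbb{R}$ be a convex function on an interval $I\subset\mathbb{R}$ and let $\phi:I\to\mathbb{R}\cup\{\pm\infty\}$ be any function with $\Phi'_-(u)\le\phi(u)\le\Phi'_+(u)$ for all $u\in I$, such that $I\supset f_0(Q)$ for some representative $f_0$ of $f$ and such that $$\Phi\circ f,\ \Phi\circ g\in L^1(Q,\mathbb{R})\quad\text{and}\quad\phi\circ g\in L^2(Q,\mathbb{R})\qquad\text{for all }g\in L^2_\sigma(Q,I).$$ Then $f^*$ is a minimizer of the functional $J^\Phi_{f,w}$ on $L^2_\sigma(Q,I)$ given by $$J^\Phi_{f,w}(g):=\int_Q\Delta_\Phi(f(x),g(x))\,w(x)\,dx\qquad(g\in L^2_\sigma(Q,I)),$$ where $\Delta_\Phi(u,v):=\Phi(u)-\Phi(v)-\phi(v)(u-v)$ for $u,v\in I$. If $\Phi$ is even strictly convex, then $f^*$ is the only minimizer of $J^\Phi_{f,w}$ on $L^2_\sigma(Q,I)$.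
   Context: Let $Q=[a_1,b_1]\times\dots\times[a_d,b_d]\subset\mathbb{R}^d$ with $a_i<b_i$, and $\sigma\in\{-1,0,1\}^d$. For $x,y\in\mathbb{R}^d$ write $x\le_\sigma y$ iff $\sigma_ix_i\le\sigma_iy_i$ for all $i$ with $\sigma_i=\pm1$ and $x_i=y_i$ for all $i$ with $\sigma_i=0$. For $X\subset\mathbb{R}^d$, a function $f:X\to\mathbb{R}$ is $\sigma$-monotonic iff $x\le_\sigma y$ implies $f(x)\le f(y)$ for all $x,y\in X$. For an interval $I\subset\mathbb{R}$, $L^2_\sigma(Q,I)$ is the set of $f\in L^2(Q,\mathbb{R})$ (Lebesgue measure) with $f(x)\in I$ for a.e. $x$ such that some (equivalently every) representative $f_0$ of $f$ is $\sigma$-monotonic on $Q\setminus N$ for some null set $N$. For a measurable $w$ on $Q$ bounded (a.e.) above and below by positive constants and $f\in L^2(Q,\mathbb{R})$, $p_\sigma^w(f)$ denotes the unique minimizer of $g\mapsto\int_Q|f(x)-g(x)|^2w(x)\,dx$ over $g\in L^2_\sigma(Q,\mathbb{R})$. $\Phi'_-(u)$ and $\Phi'_+(u)$ denote the left and right derivative of $\Phi$ at $u$ in the sense of Rockafellar's "Convex Analysis", i.e. $\Phi$ is extended by $+\infty$ outside $I$, so that $\Phi'_-=-\infty$ at the left endpoint of $I$ and $\Phi'_+=+\infty$ at the right endpoint of $I$ (if these belong to $I$). Grids: given partitions $a_i=t_{i0}<t_{i1}<\dots<t_{im_i}=b_i$ of $[a_i,b_i]$, the associated grid on $Q$ is $G=G_1\times\dots\times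 G_d$ with $G_i=\{(t_{i,k-1}+t_{ik})/2:k=1,\dots,m_i\}$. It is dyadic iff there is an $n\in\mathbb{N}$ (independent of $i$) with $m_i=2^n$ and $t_{ik}-t_{i,k-1}=(b_i-a_i)/2^n$ for all $i$ and $k\in\{1,\dots,2^n\}$. A cell of $G$ is a set $I_1\times\dots\times I_d$ where each $I_i$ is either $[t_{i,k-1},t_{ik})$ for some $k\in\{1,\dots,m_i-1\}$ or $[t_{i,m_i-1},t_{im_i}]$. A function on $Q$ is dyadically grid-constant iff it is constant on each cell of some dyadic grid on $Q$. $S(Q,J)$ is the set of dyadically grid-constant functions on $Q$ with values in $J\subset\mathbb{R}$, and $S^\infty(Q,(0,\infty)):=\bigcup_{c\in(0,\infty)}\overline{S(Q,[c,\infty))}^{\|\cdot\|_\infty}$ (closures in $L^\infty(Q,\mathbb{R})$ w.r.t. the essential supremum norm). Every $w\in S^\infty(Q,(0,\infty))$ is a.e. bounded above and below by positive constants. *)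

theory Defs
  imports "HOL-Analysis.Analysis" "HOL-Probability.Essential_Supremum"
begin

text \<open>
  Elements of the spaces \<open>L\<^sup>2(Q)\<close> and \<open>L\<^sup>\<infinity>(Q)\<close> are rendered by their representatives, that is, by
  functions on the whole space of which only the values almost everywhere on \<open>Q\<close> matter;
  equality of elements is equality almost everywhere with respect to \<^term>\<open>lebesgue_on Q\<close>.
\<close>

subsection \<open>Monotonicity with respect to a sign vector\<close>

definition sigma_le :: "real^'n \<Rightarrow> real^'n \<Rightarrow> real^'n \<Rightarrow> bool" where
  "sigma_le \<sigma> x y \<longleftrightarrow>
     (\<forall>i. (\<sigma> $ i = 1 \<or> \<sigma> $ i = - 1 \<longrightarrow> \<sigma> $ i * x $ i \<le> \<sigma> $ i * y $ i) \<and>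
          (\<sigma> $ i = 0 \<longrightarrow> x $ i = y $ i))"

definition sigma_mono_on :: "real^'n \<Rightarrow> (real^'n) set \<Rightarrow> (real^'n \<Rightarrow> real) \<Rightarrow> bool" where
  "sigma_mono_on \<sigma> X f \<longleftrightarrow> (\<forall>x\<in>X. \<forall>y\<in>X. sigma_le \<sigma> x y \<longrightarrow> f x \<le> f y)"

definition L2 :: "(real^'n) set \<Rightarrow> (real^'n \<Rightarrow> real) set" where
  "L2 Q = {f \<in> borel_measurable (lebesgue_on Q). integrable (lebesgue_on Q) (\<lambda>x. (f x)\<^sup>2)}"

text \<open>
  Monotonicity outside a null set is asked of the given representative; since the null set \<open>N\<close>
  may be enlarged, this is the same as asking it of some (or of every) representative.
\<close>

definition L2_sigma :: "real^'n \<Rightarrow> (real^'n) set \<Rightarrow> real set \<Rightarrow> (real^'n \<Rightarrow> real) set" where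
  "L2_sigma \<sigma> Q I =
     {f \<in> L2 Q. (AE x in lebesgue_on Q. f x \<in> I) \<and>
                (\<exists>N \<in> null_sets lebesgue. sigma_mono_on \<sigma> (Q - N) f)}"

text \<open>
  The weighted projection. The minimizer is unique only up to equality almost everywhere, so
  \<^const>\<open>arg_min_on\<close> selects a representative of it.
\<close>

definition sigma_proj ::
    "real^'n \<Rightarrow> (real^'n) set \<Rightarrow> (real^'n \<Rightarrow> real) \<Rightarrow> (real^'n \<Rightarrow> real) \<Rightarrow> (real^'n \<Rightarrow> real)" where
  "sigma_proj \<sigma> Q w f =
     arg_min_on (\<lambda>g. LINT x|lebesgue_on Q. \<bar>f x - g x\<bar>\<^sup>2 * w x) (L2_sigma \<sigma> Q UNIV)"

subsection \<open>Dyadic grids and the class of weights\<close>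

text \<open>
  A grid on \<^term>\<open>cbox a b\<close> is represented by the partitions \<open>t i 0 < \<dots> < t i (m i)\<close> of the edges
  from which it arises; the midpoints forming the grid itself play no role for its cells.
\<close>

definition is_grid :: "real^'n \<Rightarrow> real^'n \<Rightarrow> ('n \<Rightarrow> nat) \<Rightarrow> ('n \<Rightarrow> nat \<Rightarrow> real) \<Rightarrow> bool" where
  "is_grid a b m t \<longleftrightarrow>
     (\<forall>i. m i \<ge> 1 \<and> t i 0 = a $ i \<and> t i (m i) = b $ i \<and> (\<forall>k\<in>{1..m i}. t i (k - 1) < t i k))"

definition is_dyadic_grid :: "real^'n \<Rightarrow> real^'n \<Rightarrow> ('n \<Rightarrow> nat) \<Rightarrow> ('n \<Rightarrow> nat \<Rightarrow> real) \<Rightarrow> bool" where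
  "is_dyadic_grid a b m t \<longleftrightarrow> is_grid a b m t \<and>
     (\<exists>n::nat. \<forall>i. m i = 2 ^ n \<and>
        (\<forall>k\<in>{1..2 ^ n}. t i k - t i (k - 1) = (b $ i - a $ i) / 2 ^ n))"

definition edge_cells :: "nat \<Rightarrow> (nat \<Rightarrow> real) \<Rightarrow> real set set" where
  "edge_cells m t = insert {t (m - 1)..t m} ((\<lambda>k. {t (k - 1)..<t k}) ` {1..m - 1})"

definition grid_cells :: "('n \<Rightarrow> nat) \<Rightarrow> ('n \<Rightarrow> nat \<Rightarrow> real) \<Rightarrow> (real^'n) set set" where
  "grid_cells m t = {{x. \<forall>i. x $ i \<in> C i} | C. \<forall>i. C i \<in> edge_cells (m i) (t i)}"

definition dyadic_step :: "real^'n \<Rightarrow> real^'n \<Rightarrow> real set \<Rightarrow> (real^'n \<Rightarrow> real) set" where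
  "dyadic_step a b J =
     {s. (\<exists>m t. is_dyadic_grid a b m t \<and> (\<forall>C\<in>grid_cells m t. s constant_on C)) \<and>
         s ` cbox a b \<subseteq> J}"

definition Linf_norm :: "(real^'n) set \<Rightarrow> (real^'n \<Rightarrow> real) \<Rightarrow> ereal" where
  "Linf_norm Q f = esssup (lebesgue_on Q) (\<lambda>x. ereal \<bar>f x\<bar>)"

definition Linf :: "(real^'n) set \<Rightarrow> (real^'n \<Rightarrow> real) set" where
  "Linf Q = {f \<in> borel_measurable (lebesgue_on Q). Linf_norm Q f < \<infinity>}"

definition Linf_closure :: "(real^'n) set \<Rightarrow> (real^'n \<Rightarrow> real) set \<Rightarrow> (real^'n \<Rightarrow> real) set" where
  "Linf_closure Q A =
     {f \<in> Linf Q. \<forall>\<epsilon>>0. \<exists>s\<in>A. Linf_norm Q (\<lambda>x. f x - s x) < ereal \<epsilon>}"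

definition S_inf_pos :: "real^'n \<Rightarrow> real^'n \<Rightarrow> (real^'n \<Rightarrow> real) set" where
  "S_inf_pos a b = (\<Union>c\<in>{0<..}. Linf_closure (cbox a b) (dyadic_step a b {c..}))"

subsection \<open>Convex functions and the induced functional\<close>

definition strictly_convex_on :: "real set \<Rightarrow> (real \<Rightarrow> real) \<Rightarrow> bool" where
  "strictly_convex_on I \<Phi> \<longleftrightarrow> convex I \<and>
     (\<forall>u\<in>I. \<forall>v\<in>I. \<forall>t\<in>{0<..<1}. u \<noteq> v \<longrightarrow>
        \<Phi> ((1 - t) * u + t * v) < (1 - t) * \<Phi> u + t * \<Phi> v)"

definition ext_fun :: "real set \<Rightarrow> (real \<Rightarrow> real) \<Rightarrow> real \<Rightarrow> ereal" where
  "ext_fun I \<Phi> u = (if u \<in> I then ereal (\<Phi> u) else \<infinity>)"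

text \<open>
  One-sided derivatives at points of \<open>I\<close> of the function extended by \<open>\<infinity>\<close>. At an end point of \<open>I\<close>
  lying in \<open>I\<close> the outer difference quotients are \<open>\<infinity>\<close> divided by a nonzero real, so that the
  outer derivative is \<open>-\<infinity>\<close> on the left and \<open>\<infinity>\<close> on the right.
\<close>

definition left_deriv :: "real set \<Rightarrow> (real \<Rightarrow> real) \<Rightarrow> real \<Rightarrow> ereal" where
  "left_deriv I \<Phi> u = Lim (at_left u) (\<lambda>z. (ext_fun I \<Phi> z - ext_fun I \<Phi> u) / ereal (z - u))"

definition right_deriv :: "real set \<Rightarrow> (real \<Rightarrow> real) \<Rightarrow> real \<Rightarrow> ereal" where
  "right_deriv I \<Phi> u = Lim (at_right u) (\<lambda>z. (ext_fun I \<Phi> z - ext_fun I \<Phi> u) / ereal (z - u))"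

definition bregman :: "(real \<Rightarrow> real) \<Rightarrow> (real \<Rightarrow> ereal) \<Rightarrow> real \<Rightarrow> real \<Rightarrow> ereal" where
  "bregman \<Phi> \<phi> u v = ereal (\<Phi> u) - ereal (\<Phi> v) - \<phi> v * ereal (u - v)"

text \<open>
  The values of \<^const>\<open>bregman\<close> may be infinite only where \<open>\<phi>\<close> is; for the functions \<open>g\<close> to which
  the functional is applied, \<open>\<phi> \<circ> g\<close> is finite almost everywhere.
\<close>

definition bregman_functional ::
    "(real \<Rightarrow> real) \<Rightarrow> (real \<Rightarrow> ereal) \<Rightarrow> (real^'n) set \<Rightarrow> (real^'n \<Rightarrow> real) \<Rightarrow> (real^'n \<Rightarrow> real) \<Rightarrow>
     (real^'n \<Rightarrow> real) \<Rightarrow> real" where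
  "bregman_functional \<Phi> \<phi> Q f w g =
     (LINT x|lebesgue_on Q. real_of_ereal (bregman \<Phi> \<phi> (f x) (g x)) * w x)"

end

theory Submission
  imports Defs "HOL-Probability.Conditional_Expectation"
begin

text \<open>
  Work in \<open>L\<^sup>2(w dx)\<close>, where \<open>f\<^sup>*\<close> is the metric projection of \<open>f\<close> onto the closed convex cone
  of \<open>\<sigma>\<close>-monotonic functions. If \<open>\<theta>\<close> is bounded, nondecreasing and Lipschitz, then both
  \<open>f\<^sup>* + \<epsilon> \<theta>(f\<^sup>*)\<close> and \<open>f\<^sup>* - \<epsilon> \<theta>(f\<^sup>*)\<close> lie in the cone for small \<open>\<epsilon>\<close>, so \<open>f - f\<^sup>*\<close> is
  orthogonal to \<open>\<theta>(f\<^sup>*)\<close>. Approximating indicators of half-lines shows that \<open>f\<^sup>*\<close> is the conditional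
  expectation of \<open>f\<close> given the \<open>\<sigma>\<close>-algebra generated by \<open>f\<^sup>*\<close>. Hence \<open>f\<^sup>*\<close> takes values in \<open>I\<close>, and
  \<open>f - f\<^sup>*\<close> is orthogonal to \<open>\<phi>(f\<^sup>*)\<close>. In the identity
  \<open>J(g) - J(f\<^sup>*) = \<integral> \<Delta>(f\<^sup>*, g) w + \<integral> (\<phi>(f\<^sup>*) - \<phi>(g)) (f - f\<^sup>*) w\<close> the first integral is
  nonnegative by convexity (and vanishes only for \<open>g = f\<^sup>*\<close> if \<open>\<Phi>\<close> is strictly convex), while the second
  is nonnegative because \<open>\<phi>(g)\<close> is again in the cone, so that \<open>\<integral> \<phi>(g) (f - f\<^sup>*) w \<le> 0\<close>.
\<close>

subsection \<open>Square integrable functions\<close>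

text \<open>The measure is arbitrary so that both \<open>lebesgue_on Q\<close> and its density
  \<open>w dx\<close> are covered.\<close>

definition square_integrable :: "'a measure \<Rightarrow> ('a \<Rightarrow> real) set" where
  "square_integrable M = {g \<in> borel_measurable M. integrable M (\<lambda>x. (g x)\<^sup>2)}"

lemma square_integrable_measurable [measurable_dest]:
  "g \<in> square_integrable M \<Longrightarrow> g \<in> borel_measurable M"
  by (simp add: square_integrable_def)

lemma square_integrable_square: "g \<in> square_integrable M \<Longrightarrow> integrable M (\<lambda>x. (g x)\<^sup>2)"
  by (simp add: square_integrable_def)

lemma square_integrable_mult:
  assumes [measurable]: "g \<in> square_integrable M" "h \<in> square_integrable M"
  shows "integrable M (\<lambda>x. g x * h x)"
proof (rule Bochner_Integration.integrable_bound)
  show "integrable M (\<lambda>x. (g x)\<^sup>2 + (h x)\<^sup>2)"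
    using assms by (simp add: square_integrable_square)
  have "\<bar>g x * h x\<bar> \<le> (g x)\<^sup>2 + (h x)\<^sup>2" for x
    using sum_squares_bound[of "\<bar>g x\<bar>" "\<bar>h x\<bar>"] mult_nonneg_nonneg[of "\<bar>g x\<bar>" "\<bar>h x\<bar>"]
    unfolding abs_mult power2_abs by linarith
  then show "AE x in M. norm (g x * h x) \<le> norm ((g x)\<^sup>2 + (h x)\<^sup>2)"
    by (intro AE_I2) (auto intro: order_trans)
qed measurable

lemma square_integrable_cmult:
  "g \<in> square_integrable M \<Longrightarrow> (\<lambda>x. c * g x) \<in> square_integrable M"
  by (auto simp: square_integrable_def power_mult_distrib)

lemma square_integrable_add:
  assumes [measurable]: "g \<in> square_integrable M" "h \<in> square_integrable M"
  shows "(\<lambda>x. g x + h x) \<in> square_integrable M"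
  using assms square_integrable_mult[OF assms]
  by (simp add: square_integrable_def power2_sum mult.assoc)

lemma square_integrable_diff:
  assumes "g \<in> square_integrable M" "h \<in> square_integrable M"
  shows "(\<lambda>x. g x - h x) \<in> square_integrable M"
  using square_integrable_add[OF assms(1) square_integrable_cmult[OF assms(2), of "-1"]] by simp

lemma (in finite_measure) square_integrable_const: "(\<lambda>_. c) \<in> square_integrable M"
  by (simp add: square_integrable_def)

lemma (in finite_measure) square_integrable_integrable:
  "g \<in> square_integrable M \<Longrightarrow> integrable M g"
  using square_integrable_mult[OF _ square_integrable_const[of 1]] by simp

lemma (in finite_measure) square_integrable_bounded:
  assumes [measurable]: "g \<in> borel_measurable M" and b: "\<And>x. \<bar>g x\<bar> \<le> B"
  shows "g \<in> square_integrable M"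
proof -
  have "(g x)\<^sup>2 \<le> B\<^sup>2" for x
    using b[of x] by (metis abs_ge_zero power2_abs power_mono)
  then have "integrable M (\<lambda>x. (g x)\<^sup>2)"
    by (intro integrable_const_bound[of _ "B\<^sup>2"]) auto
  then show ?thesis by (simp add: square_integrable_def)
qed

text \<open>Riesz-Fischer argument: on a finite measure space the increments are summable in mean,
  hence absolutely summable at almost every point, and they telescope.\<close>

lemma (in finite_measure) fast_L2_Cauchy_imp_AE_convergent:
  assumes h: "\<And>n. h n \<in> square_integrable M"
    and le: "\<And>n. (LINT x|M. (h (Suc n) x - h n x)\<^sup>2) \<le> (1/4) ^ n"
  shows "AE x in M. convergent (\<lambda>n. h n x)"
proof -
  have [measurable]: "h n \<in> borel_measurable M" for n using h by measurable
  define m where "m = measure M (space M)"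
  define d where "d n x = \<bar>h (Suc n) x - h n x\<bar>" for n x
  have [measurable]: "d n \<in> borel_measurable M" for n unfolding d_def by measurable
  have dsq: "d n \<in> square_integrable M" for n
    using square_integrable_diff[OF h h, of "Suc n" n] unfolding d_def square_integrable_def by simp
  have bound: "(LINT x|M. d n x) \<le> (1 + m) * (1/2) ^ n" for n
  proof -
    have "(LINT x|M. d n x) \<le> (LINT x|M. 2 ^ n * (d n x)\<^sup>2 + (1/2) ^ n)"
    proof (rule integral_mono)
      fix x
      \<comment> \<open>Applied to t = 2^n * d n x. The scaling 2^n balances the two terms: the
        square contributes 2^n * (1/4)^n = (1/2)^n, the constant contributes (1/2)^n times the total
        mass.\<close>
      have sq: "t \<le> t\<^sup>2 + 1" for t :: real
        using sum_squares_bound[of t 1] zero_le_power2[of t] unfolding power_one mult_1_right by linarith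
      have one: "2 ^ n * (1/2::real) ^ n = 1"
        by (simp add: power_divide)
      have "d n x = d n x * 2 ^ n * (1/2) ^ n"
        using one by (simp only: mult.assoc mult_1_right)
      also have "\<dots> \<le> ((d n x * 2 ^ n)\<^sup>2 + 1) * (1/2) ^ n"
        by (intro mult_right_mono sq) simp
      also have "\<dots> = 2 ^ n * (d n x)\<^sup>2 * (2 ^ n * (1/2) ^ n) + (1/2) ^ n"
        unfolding distrib_right by (simp only: power2_eq_square mult_1_left mult_ac)
      finally show "d n x \<le> 2 ^ n * (d n x)\<^sup>2 + (1/2) ^ n"
        by (simp only: one mult_1_right)
    qed (use dsq in \<open>auto intro: square_integrable_integrable simp: square_integrable_square\<close>)
    also have "\<dots> = 2 ^ n * (LINT x|M. (d n x)\<^sup>2) + (1/2) ^ n * m"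
      using dsq by (simp add: square_integrable_square m_def)
    also have "\<dots> \<le> 2 ^ n * (1/4) ^ n + (1/2) ^ n * m"
      using le[of n] by (simp add: d_def)
    also have "2 ^ n * (1/4::real) ^ n = (2 * (1/4)) ^ n"
      by (rule power_mult_distrib[symmetric])
    also have "2 * (1/4::real) = 1/2" by simp
    finally show ?thesis by (simp add: algebra_simps)
  qed
  have "(\<integral>\<^sup>+ x. (\<Sum>n. ennreal (d n x)) \<partial>M) = (\<Sum>n. \<integral>\<^sup>+ x. ennreal (d n x) \<partial>M)"
    by (rule nn_integral_suminf) measurable
  also have "\<dots> \<le> (\<Sum>n. ennreal ((1 + m) * (1/2) ^ n))"
  proof (rule suminf_le)
    fix n
    have "(\<integral>\<^sup>+ x. ennreal (d n x) \<partial>M) = ennreal (LINT x|M. d n x)"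
      using square_integrable_integrable[OF dsq] by (rule nn_integral_eq_integral) (simp add: d_def)
    then show "(\<integral>\<^sup>+ x. ennreal (d n x) \<partial>M) \<le> ennreal ((1 + m) * (1/2) ^ n)"
      using bound[of n] by (simp add: ennreal_leI)
  qed auto
  also have "\<dots> < \<infinity>"
  proof -
    have "summable (\<lambda>n. (1 + m) * (1/2::real) ^ n)"
      by (intro summable_mult summable_geometric) simp
    then have "(\<Sum>n. ennreal ((1 + m) * (1/2) ^ n)) \<noteq> top"
      by (rule ennreal_suminf_neq_top) (simp add: m_def)
    then show ?thesis by (simp add: less_top)
  qed
  finally have "AE x in M. (\<Sum>n. ennreal (d n x)) \<noteq> \<infinity>"
    by (intro nn_integral_PInf_AE) auto
  then show ?thesis
  proof eventually_elim
    fix x assume "(\<Sum>n. ennreal (d n x)) \<noteq> \<infinity>"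
    then have "summable (\<lambda>n. \<bar>h (Suc n) x - h n x\<bar>)"
      by (intro summable_suminf_not_top) (auto simp: d_def)
    then have "summable (\<lambda>n. h (Suc n) x - h n x)"
      by (rule summable_rabs_cancel)
    then have "convergent (\<lambda>n. \<Sum>k<n. h (Suc k) x - h k x)"
      by (simp add: summable_iff_convergent)
    then have "convergent (\<lambda>n. h n x - h 0 x)"
      by (simp add: sum_lessThan_telescope[of "\<lambda>n. h n x"])
    then show "convergent (\<lambda>n. h n x)"
      by (simp add: convergent_diff_const_right_iff)
  qed
qed

subsection \<open>Projections onto cones closed under monotone transformations\<close>

text \<open>In \<open>mono_comp\<close> the map need be monotone only on a set \<open>A\<close>
  containing almost all values of \<open>g\<close>, because \<phi> is finite and monotone only on
  part of the line. Closedness is put as \<open>AE_limit\<close> because monotonicity off a null set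
  passes directly to limits almost everywhere.\<close>

locale isotone_cone = finite_measure M for M :: "'a measure" +
  fixes K :: "('a \<Rightarrow> real) set"
  assumes square_integrable: "g \<in> K \<Longrightarrow> g \<in> square_integrable M"
    and zero: "(\<lambda>_. 0) \<in> K"
    and add: "g \<in> K \<Longrightarrow> h \<in> K \<Longrightarrow> (\<lambda>x. g x + h x) \<in> K"
    and scale: "g \<in> K \<Longrightarrow> 0 \<le> c \<Longrightarrow> (\<lambda>x. c * g x) \<in> K"
    and mono_comp: "g \<in> K \<Longrightarrow> mono_on A \<theta> \<Longrightarrow> AE x in M. g x \<in> A \<Longrightarrow>
      (\<lambda>x. \<theta> (g x)) \<in> square_integrable M \<Longrightarrow> (\<lambda>x. \<theta> (g x)) \<in> K"
    and AE_limit: "(\<And>n. H n \<in> K) \<Longrightarrow> AE x in M. (\<lambda>n. H n x) \<longlonglongrightarrow> g x \<Longrightarrow>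
      g \<in> square_integrable M \<Longrightarrow> g \<in> K"
begin

text \<open>A minimizing sequence of prescribed speed is Cauchy by the parallelogram law, so it
  converges almost everywhere, and Fatou's lemma makes its limit a minimizer.\<close>

lemma projection_exists:
  assumes f: "f \<in> square_integrable M"
  shows "\<exists>p\<in>K. \<forall>h\<in>K. (LINT x|M. (f x - p x)\<^sup>2) \<le> (LINT x|M. (f x - h x)\<^sup>2)"
proof -
  define E where "E h = (LINT x|M. (f x - h x)\<^sup>2)" for h
  define D where "D = Inf (E ` K)"
  have bdd: "bdd_below (E ` K)"
    by (intro bdd_belowI[of _ 0]) (auto simp: E_def)
  have ne: "E ` K \<noteq> {}" using zero by auto
  have D_le: "D \<le> E h" if "h \<in> K" for h
    unfolding D_def using that bdd by (intro cInf_lower) auto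
  have D0: "0 \<le> D"
    unfolding D_def using ne by (intro cInf_greatest) (auto simp: E_def)
  \<comment> \<open>With this excess the parallelogram law bounds the squared distance of
    consecutive terms by 2/4 + 2/16 = 5/8 times (1/4)^n, fast enough for convergence almost
    everywhere.\<close>
  have "\<exists>h\<in>K. E h < D + (1/4) ^ n / 4" for n :: nat
    using cInf_lessD[OF ne, of "D + (1/4) ^ n / 4"] by (auto simp: D_def)
  then obtain h where hK: "\<And>n. h n \<in> K" and hE: "\<And>n::nat. E (h n) < D + (1/4) ^ n / 4"
    by metis
  have hsq: "h n \<in> square_integrable M" for n using hK square_integrable by auto
  note [measurable] = hsq f
  have near: "(LINT x|M. (h (Suc n) x - h n x)\<^sup>2) \<le> (1/4) ^ n" for n
  proof -
    \<comment> \<open>The midpoint stays in the cone, so its distance to \<open>f\<close> is at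
      least the infimum \<open>D\<close>.\<close>
    define mid where "mid = (\<lambda>x. (1/2) * (h (Suc n) x + h n x))"
    have midK: "mid \<in> K" unfolding mid_def by (intro scale add hK) simp
    have "(LINT x|M. (h (Suc n) x - h n x)\<^sup>2)
        = (LINT x|M. 2 * (f x - h (Suc n) x)\<^sup>2 + 2 * (f x - h n x)\<^sup>2 - 4 * (f x - mid x)\<^sup>2)"
      by (intro Bochner_Integration.integral_cong)
        (auto simp: mid_def power2_eq_square algebra_simps)
    also have "\<dots> = 2 * E (h (Suc n)) + 2 * E (h n) - 4 * E mid"
      unfolding E_def
      using square_integrable_square[OF square_integrable_diff[OF f hsq[of "Suc n"]]]
        square_integrable_square[OF square_integrable_diff[OF f hsq[of n]]]
        square_integrable_square[OF square_integrable_diff[OF f square_integrable[OF midK]]]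
      by simp
    also have "\<dots> \<le> (1/4) ^ n"
      using hE[of n] hE[of "Suc n"] D_le[OF midK] zero_le_power[of "1/4::real" n]
      unfolding power_Suc by linarith
    finally show ?thesis .
  qed
  \<comment> \<open>Where the sequence diverges, \<open>lim\<close> is an unspecified value; this
    happens on a null set only.\<close>
  define p where "p x = lim (\<lambda>n. h n x)" for x
  have [measurable]: "p \<in> borel_measurable M" unfolding p_def by measurable
  have lim: "AE x in M. (\<lambda>n. h n x) \<longlonglongrightarrow> p x"
    using fast_L2_Cauchy_imp_AE_convergent[of h, OF hsq near]
    by eventually_elim (simp add: p_def convergent_LIMSEQ_iff)
  have Efin: "(\<integral>\<^sup>+ x. ennreal ((f x - h n x)\<^sup>2) \<partial>M) = ennreal (E (h n))" for n
    unfolding E_def using square_integrable_square[OF square_integrable_diff[OF f hsq]]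
    by (intro nn_integral_eq_integral) auto
  have "(\<integral>\<^sup>+ x. ennreal ((f x - p x)\<^sup>2) \<partial>M) = (\<integral>\<^sup>+ x. liminf (\<lambda>n. ennreal ((f x - h n x)\<^sup>2)) \<partial>M)"
  proof (rule nn_integral_cong_AE)
    show "AE x in M. ennreal ((f x - p x)\<^sup>2) = liminf (\<lambda>n. ennreal ((f x - h n x)\<^sup>2))"
      using lim
    proof eventually_elim
      fix x assume "(\<lambda>n. h n x) \<longlonglongrightarrow> p x"
      then have "(\<lambda>n. ennreal ((f x - h n x)\<^sup>2)) \<longlonglongrightarrow> ennreal ((f x - p x)\<^sup>2)"
        by (intro tendsto_ennrealI tendsto_intros)
      then show "ennreal ((f x - p x)\<^sup>2) = liminf (\<lambda>n. ennreal ((f x - h n x)\<^sup>2))"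
        using lim_imp_Liminf[OF sequentially_bot] by metis
    qed
  qed
  also have "\<dots> \<le> liminf (\<lambda>n. \<integral>\<^sup>+ x. ennreal ((f x - h n x)\<^sup>2) \<partial>M)"
    by (intro nn_integral_liminf) auto
  also have "\<dots> \<le> liminf (\<lambda>n. ennreal (D + (1/4) ^ n / 4))"
    unfolding Efin using hE by (intro Liminf_mono always_eventually allI ennreal_leI less_imp_le)
  also have "\<dots> = ennreal D"
  proof (rule lim_imp_Liminf)
    have "(\<lambda>n. D + (1/4) ^ n / 4) \<longlonglongrightarrow> D + 0 / 4"
      by (intro tendsto_intros LIMSEQ_power_zero) auto
    then show "(\<lambda>n. ennreal (D + (1/4) ^ n / 4)) \<longlonglongrightarrow> ennreal D"
      by (intro tendsto_ennrealI) simp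
  qed simp
  finally have le: "(\<integral>\<^sup>+ x. ennreal ((f x - p x)\<^sup>2) \<partial>M) \<le> ennreal D" .
  \<comment> \<open>The Fatou bound also shows that f - p, and hence p = f - (f - p), is square
    integrable, as \<open>AE_limit\<close> demands.\<close>
  have int: "integrable M (\<lambda>x. (f x - p x)\<^sup>2)"
    using le by (intro integrableI_bounded) (auto intro: le_less_trans)
  have "(\<lambda>x. f x - p x) \<in> square_integrable M"
    using int by (simp add: square_integrable_def)
  from square_integrable_diff[OF f this] have psq: "p \<in> square_integrable M" by simp
  have "ennreal (E p) \<le> ennreal D"
    using le nn_integral_eq_integral[OF int] by (simp add: E_def)
  then have "E p \<le> D" using D0 by (simp add: ennreal_le_iff)
  moreover have "p \<in> K" using AE_limit[OF hK lim psq] .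
  ultimately show ?thesis using D_le unfolding E_def by (meson order_trans)
qed


section \<open>Orthogonality of the residual to functions of the projection\<close>

definition projects :: "('a \<Rightarrow> real) \<Rightarrow> ('a \<Rightarrow> real) \<Rightarrow> bool" where
  "projects f p \<longleftrightarrow> p \<in> K \<and> (\<forall>h\<in>K. (LINT x|M. (f x - p x)\<^sup>2) \<le> (LINT x|M. (f x - h x)\<^sup>2))"

text \<open>The squared distance to \<open>f\<close> along p + \<delta> h is quadratic in \<delta>
  and cannot decrease to first order at 0. The direction \<open>h\<close> itself may lie outside the
  cone, which permits both signs of \<theta>(p) later.\<close>

lemma projects_variation:
  assumes f: "f \<in> square_integrable M" and p: "projects f p" and h: "h \<in> square_integrable M"
    and e: "0 < \<epsilon>" and K: "\<And>\<delta>. 0 < \<delta> \<Longrightarrow> \<delta> \<le> \<epsilon> \<Longrightarrow> (\<lambda>x. p x + \<delta> * h x) \<in> K"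
  shows "(LINT x|M. h x * (f x - p x)) \<le> 0"
proof (rule ccontr)
  define A where "A = (LINT x|M. h x * (f x - p x))"
  define B where "B = (LINT x|M. (h x)\<^sup>2)"
  assume "\<not> (LINT x|M. h x * (f x - p x)) \<le> 0"
  then have A: "0 < A" by (simp add: A_def)
  have B: "0 \<le> B" by (simp add: B_def)
  \<comment> \<open>Admissible and so small that the quadratic term \<delta> * B stays below the
    linear gain 2 * A; adding 1 avoids division by zero.\<close>
  define \<delta> where "\<delta> = min \<epsilon> (A / (B + 1))"
  have d: "0 < \<delta>" "\<delta> \<le> \<epsilon>" using A B e by (auto simp: \<delta>_def)
  have fp: "(\<lambda>x. f x - p x) \<in> square_integrable M"
    using f p square_integrable by (auto simp: projects_def intro: square_integrable_diff)
  have "(LINT x|M. (f x - p x)\<^sup>2) \<le> (LINT x|M. (f x - (p x + \<delta> * h x))\<^sup>2)"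
    using p K[OF d] by (auto simp: projects_def)
  also have "\<dots> = (LINT x|M. (f x - p x)\<^sup>2 - 2 * \<delta> * (h x * (f x - p x)) + \<delta>\<^sup>2 * (h x)\<^sup>2)"
    by (intro Bochner_Integration.integral_cong) (auto simp: power2_eq_square algebra_simps)
  also have "\<dots> = (LINT x|M. (f x - p x)\<^sup>2) - 2 * \<delta> * A + \<delta>\<^sup>2 * B"
    using square_integrable_mult[OF h fp] square_integrable_square[OF h] square_integrable_square[OF fp]
    by (simp add: A_def B_def)
  finally have "\<delta> * (2 * A) \<le> \<delta> * (\<delta> * B)" by (simp add: power2_eq_square algebra_simps)
  then have "2 * A \<le> \<delta> * B" using d by simp
  also have "\<dots> \<le> A / (B + 1) * B" using B by (intro mult_right_mono) (auto simp: \<delta>_def)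
  also have "\<dots> \<le> A" using A B by (simp add: field_simps)
  finally show False using A by simp
qed

text \<open>For h in the cone, p + \<delta> h stays in the cone for all \<delta> > 0; thus the
  residual lies in the polar cone.\<close>

lemma projects_polar:
  assumes "f \<in> square_integrable M" "projects f p" "h \<in> K"
  shows "(LINT x|M. h x * (f x - p x)) \<le> 0"
proof (rule projects_variation[of f p h 1])
  show "(\<lambda>x. p x + \<delta> * h x) \<in> K" if "0 < \<delta>" for \<delta>
    using assms that by (intro add scale) (auto simp: projects_def)
qed (use assms square_integrable in auto)

text \<open>For nondecreasing \<theta>, the last hypothesis says that \<theta> is Lipschitz with
  constant 1/\<epsilon>. It makes p - \<delta> \<theta>(p) a nondecreasing function of p for small
  \<delta>, which supplies the inequality opposite to polarity.\<close>

lemma projects_orthogonal_Lipschitz: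
  assumes f: "f \<in> square_integrable M" and p: "projects f p"
    and \<theta>: "mono \<theta>" "\<And>u. \<bar>\<theta> u\<bar> \<le> B" and e: "0 < \<epsilon>" "mono (\<lambda>u. u - \<epsilon> * \<theta> u)"
  shows "(LINT x|M. \<theta> (p x) * (f x - p x)) = 0"
proof (rule antisym)
  have pK: "p \<in> K" using p by (simp add: projects_def)
  note psq [measurable] = square_integrable[OF pK]
  have [measurable]: "\<theta> \<in> borel_measurable borel" by (rule borel_measurable_mono[OF \<theta>(1)])
  have sq: "(\<lambda>x. \<theta> (p x)) \<in> square_integrable M"
    using \<theta>(2) by (intro square_integrable_bounded) auto
  have "(\<lambda>x. \<theta> (p x)) \<in> K"
    using \<theta>(1) by (intro mono_comp[OF pK _ _ sq, of UNIV]) auto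
  then show "(LINT x|M. \<theta> (p x) * (f x - p x)) \<le> 0" by (rule projects_polar[OF f p])
  have "(LINT x|M. - \<theta> (p x) * (f x - p x)) \<le> 0"
  proof (rule projects_variation[OF f p _ e(1)])
    show nsq: "(\<lambda>x. - \<theta> (p x)) \<in> square_integrable M"
      using square_integrable_cmult[OF sq, of "-1"] by simp
    fix \<delta> :: real assume \<delta>: "0 < \<delta>" "\<delta> \<le> \<epsilon>"
    have "mono (\<lambda>u. u - \<delta> * \<theta> u)"
    proof (rule monoI)
      fix u v :: real assume "u \<le> v"
      then have "\<theta> u \<le> \<theta> v" "u - \<epsilon> * \<theta> u \<le> v - \<epsilon> * \<theta> v"
        using \<theta>(1) e(2) by (auto dest: monoD)
      moreover have "\<delta> * (\<theta> v - \<theta> u) \<le> \<epsilon> * (\<theta> v - \<theta> u)"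
        using \<open>\<theta> u \<le> \<theta> v\<close> \<delta> by (intro mult_right_mono) auto
      ultimately show "u - \<delta> * \<theta> u \<le> v - \<delta> * \<theta> v" by (simp add: algebra_simps)
    qed
    moreover have "(\<lambda>x. p x - \<delta> * \<theta> (p x)) \<in> square_integrable M"
      by (intro square_integrable_diff square_integrable_cmult psq sq)
    ultimately have "(\<lambda>x. p x - \<delta> * \<theta> (p x)) \<in> K"
      by (intro mono_comp[OF pK, of UNIV "\<lambda>u. u - \<delta> * \<theta> u"]) auto
    then show "(\<lambda>x. p x + \<delta> * - \<theta> (p x)) \<in> K" by simp
  qed
  then show "0 \<le> (LINT x|M. \<theta> (p x) * (f x - p x))" by simp
qed

lemma projects_orthogonal_upper_level_set:
  assumes f: "f \<in> square_integrable M" and p: "projects f p"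
  shows "(LINT x|M. indicator {c<..} (p x) * (f x - p x)) = 0"
proof -
  have psq: "p \<in> square_integrable M" using p square_integrable by (simp add: projects_def)
  note [measurable] = f psq
  \<comment> \<open>A ramp from 0 at c to 1 at c + 1/(n+1). Its slope n+1 dictates \<epsilon> =
    1/(n+1), and its value 0 at c makes the limit the indicator of the open half-line.\<close>
  define \<theta> where "\<theta> n u = min 1 (max 0 (real (Suc n) * (u - c)))" for n u
  have mono: "mono (\<theta> n)" for n
    unfolding \<theta>_def by (intro monoI min.mono max.mono order_refl mult_left_mono) auto
  have [measurable]: "\<theta> n \<in> borel_measurable borel" for n by (rule borel_measurable_mono[OF mono])
  have mono': "mono (\<lambda>u. u - 1 / real (Suc n) * \<theta> n u)" for n
  proof (rule monoI)
    fix u v :: real assume uv: "u \<le> v"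
    have clamp: "min 1 (max 0 t) - min 1 (max 0 s) \<le> t - s" if "s \<le> t" for s t :: real
      using that by (auto simp: min_def max_def)
    have "\<theta> n v - \<theta> n u \<le> real (Suc n) * (v - c) - real (Suc n) * (u - c)"
      unfolding \<theta>_def using uv by (intro clamp mult_left_mono) auto
    also have "\<dots> = real (Suc n) * (v - u)" by (simp add: algebra_simps)
    finally have "(\<theta> n v - \<theta> n u) / real (Suc n) \<le> v - u"
      by (simp add: divide_le_eq mult.commute)
    then show "u - 1 / real (Suc n) * \<theta> n u \<le> v - 1 / real (Suc n) * \<theta> n v"
      by (simp add: diff_divide_distrib)
  qed
  have zero: "(LINT x|M. \<theta> n (p x) * (f x - p x)) = 0" for n
  proof (rule projects_orthogonal_Lipschitz[OF f p mono])
    show "\<bar>\<theta> n u\<bar> \<le> 1" for u by (simp add: \<theta>_def)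
  next
    show "0 < 1 / real (Suc n)" by simp
  qed (rule mono')
  have lim: "(\<lambda>n. \<theta> n u) \<longlonglongrightarrow> indicator {c<..} u" for u
  proof (cases "c < u")
    case True
    obtain N :: nat where N: "1 / (u - c) < real N" using reals_Archimedean2 by blast
    have "\<theta> n u = 1" if "N \<le> n" for n
    proof -
      have "1 / (u - c) < real (Suc n)" using N that by linarith
      then have "1 < real (Suc n) * (u - c)" using True by (simp add: divide_less_eq)
      then show ?thesis by (simp add: \<theta>_def)
    qed
    then show ?thesis
      using True by (intro tendsto_eventually) (auto simp: eventually_sequentially)
  next
    case False
    then have "\<theta> n u = 0" for n
      using mult_nonneg_nonpos[of "real (Suc n)" "u - c"] by (simp add: \<theta>_def)
    then show ?thesis using False by simp
  qed
  have "(\<lambda>n. LINT x|M. \<theta> n (p x) * (f x - p x))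
      \<longlonglongrightarrow> (LINT x|M. indicator {c<..} (p x) * (f x - p x))"
  proof (rule integral_dominated_convergence)
    show "integrable M (\<lambda>x. \<bar>f x - p x\<bar>)"
      using square_integrable_integrable[OF square_integrable_diff[OF f psq]] by simp
    show "AE x in M. (\<lambda>n. \<theta> n (p x) * (f x - p x)) \<longlonglongrightarrow> indicator {c<..} (p x) * (f x - p x)"
      by (intro AE_I2 tendsto_intros lim)
    show "AE x in M. norm (\<theta> n (p x) * (f x - p x)) \<le> \<bar>f x - p x\<bar>" for n
      by (intro AE_I2) (auto simp: abs_mult \<theta>_def intro!: mult_left_le_one_le)
  qed measurable
  then show ?thesis by (simp add: zero LIMSEQ_const_iff)
qed

text \<open>Dynkin argument: open half-lines are stable under intersection and generate the Borel
  sets, and the sets with vanishing integral are closed under complements and countable disjoint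
  unions.\<close>

lemma projects_set_integral_vimage:
  assumes f: "f \<in> square_integrable M" and p: "projects f p" and B: "B \<in> sets borel"
  shows "(LINT x:(p -` B \<inter> space M)|M. f x - p x) = 0"
proof -
  have psq: "p \<in> square_integrable M" using p square_integrable by (simp add: projects_def)
  note [measurable] = f psq
  have fp: "integrable M (\<lambda>x. f x - p x)"
    using square_integrable_integrable[OF square_integrable_diff[OF f psq]] by simp
  let ?G = "range (\<lambda>a::real. {a<..})"
  have G: "sets borel = sigma_sets UNIV ?G"
    by (subst borel_Ioi) (simp add: sets_measure_of_conv)
  have "Int_stable ?G"
  proof (rule Int_stableI)
    fix S T assume "S \<in> ?G" "T \<in> ?G"
    then obtain c d where "S = {c<..}" "T = {d<..}" by auto
    then have "S \<inter> T = {max c d<..}" by auto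
    then show "S \<inter> T \<in> ?G" by simp
  qed
  moreover have "?G \<subseteq> Pow UNIV" by simp
  moreover have "B \<in> sigma_sets UNIV ?G" using B G by simp
  ultimately show ?thesis
  proof (induction rule: sigma_sets_induct_disjoint)
    case (basic A)
    then obtain c where "A = {c<..}" by auto
    moreover have "(LINT x:(p -` {c<..} \<inter> space M)|M. f x - p x)
        = (LINT x|M. indicator {c<..} (p x) * (f x - p x))"
      unfolding set_lebesgue_integral_def
      by (intro Bochner_Integration.integral_cong) (auto simp: indicator_def)
    ultimately show ?case using projects_orthogonal_upper_level_set[OF f p] by simp
  next
    case empty
    show ?case by (simp add: set_lebesgue_integral_def)
  next
    case (compl A)
    then have [measurable]: "A \<in> sets borel" by (simp add: G)
    have iA: "set_integrable M (p -` A \<inter> space M) (\<lambda>x. f x - p x)"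
      unfolding set_integrable_def by (intro integrable_mult_indicator fp) measurable
    have "(LINT x:(p -` (UNIV - A) \<inter> space M)|M. f x - p x)
        = (LINT x|M. (f x - p x) - indicator (p -` A \<inter> space M) x *\<^sub>R (f x - p x))"
      unfolding set_lebesgue_integral_def
      by (intro Bochner_Integration.integral_cong) (auto simp: indicator_def)
    also have "\<dots> = (LINT x|M. f x - p x) - (LINT x:(p -` A \<inter> space M)|M. f x - p x)"
      using fp iA by (simp add: set_lebesgue_integral_def set_integrable_def)
    \<comment> \<open>The constant \<theta> = 1 is admissible: u - 1 is nondecreasing in u.\<close>
    also have "(LINT x|M. f x - p x) = 0"
      using projects_orthogonal_Lipschitz[OF f p, of "\<lambda>_. 1" 1 1] by (simp add: mono_def)
    finally show ?case using compl by simp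
  next
    case (union A)
    then have "A i \<in> sets borel" for i by (auto simp: G)
    then have [measurable]: "p -` A i \<inter> space M \<in> sets M" for i by measurable
    have eq: "p -` (\<Union>i. A i) \<inter> space M = (\<Union>i. p -` A i \<inter> space M)" by auto
    have "set_integrable M (\<Union>i. p -` A i \<inter> space M) (\<lambda>x. f x - p x)"
      unfolding set_integrable_def by (intro integrable_mult_indicator fp) measurable
    moreover have "p -` A i \<inter> space M \<inter> (p -` A j \<inter> space M) = {}" if "i \<noteq> j" for i j
      using union(1) that by (auto simp: disjoint_family_on_def)
    ultimately show ?case
      unfolding eq using union by (subst lebesgue_integral_countable_add) auto
  qed
qed

text \<open>
  The set integrals just computed say that \<open>p\<close> is the conditional expectation of \<open>f\<close> given the
  \<open>\<sigma>\<close>-algebra generated by \<open>p\<close>.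
\<close>

lemma projects_orthogonal:
  assumes f: "f \<in> square_integrable M" and p: "projects f p"
    and [measurable]: "\<theta> \<in> borel_measurable borel" and \<theta>: "(\<lambda>x. \<theta> (p x)) \<in> square_integrable M"
  shows "(LINT x|M. \<theta> (p x) * (f x - p x)) = 0"
proof -
  have psq: "p \<in> square_integrable M" using p square_integrable by (simp add: projects_def)
  note [measurable] = f psq
  define F where "F = vimage_algebra (space M) p borel"
  have sF: "sets F = {p -` B \<inter> space M |B. B \<in> sets borel}"
    unfolding F_def by (intro sets_vimage_algebra2) auto
  have sub: "subalgebra M F"
    unfolding subalgebra_def sF by (auto simp: F_def)
  interpret finite_measure_subalgebra M F by unfold_locales (rule sub)
  have pF [measurable]: "p \<in> borel_measurable F"
    unfolding F_def by (intro measurable_vimage_algebra1) auto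
  have if': "integrable M f" and ip: "integrable M p"
    using f psq by (auto intro: square_integrable_integrable)
  have ce: "AE x in M. real_cond_exp M F f x = p x"
  proof (rule real_cond_exp_charact)
    fix A assume A: "A \<in> sets F"
    then have "A \<in> sets M" using sub by (auto simp: subalgebra_def)
    then have "(LINT x:A|M. f x - p x) = (LINT x:A|M. f x) - (LINT x:A|M. p x)"
      using if' ip unfolding set_integrable_def
      by (intro set_integral_diff) (auto simp: set_integrable_def simp del: real_scaleR_def
        intro: integrable_mult_indicator)
    moreover have "(LINT x:A|M. f x - p x) = 0"
      using A projects_set_integral_vimage[OF f p] by (auto simp: sF)
    ultimately show "(LINT x:A|M. f x) = (LINT x:A|M. p x)" by simp
  qed (use if' ip pF in auto)
  have \<theta>F: "(\<lambda>x. \<theta> (p x)) \<in> borel_measurable F" by measurable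
  \<comment> \<open>Since \<theta>(p) is \<open>F\<close>-measurable, \<open>f\<close> may be
    replaced by its conditional expectation, which is p.\<close>
  have "(LINT x|M. \<theta> (p x) * f x) = (LINT x|M. \<theta> (p x) * real_cond_exp M F f x)"
    by (rule real_cond_exp_intg(2)[OF square_integrable_mult[OF \<theta> f] \<theta>F, symmetric]) measurable
  also have "\<dots> = (LINT x|M. \<theta> (p x) * p x)"
  proof (rule integral_cong_AE)
    show "AE x in M. \<theta> (p x) * real_cond_exp M F f x = \<theta> (p x) * p x"
      using ce by eventually_elim simp
  qed measurable
  finally have "(LINT x|M. \<theta> (p x) * f x) = (LINT x|M. \<theta> (p x) * p x)" .
  then show ?thesis
    using square_integrable_mult[OF \<theta> f] square_integrable_mult[OF \<theta> psq]
    by (simp add: right_diff_distrib)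
qed

text \<open>Test the orthogonality with the indicator of the values lying beyond I on one side.
  There f - p has a strict sign, so a vanishing integral forces p to avoid these values almost
  everywhere.\<close>

lemma projects_range:
  assumes f: "f \<in> square_integrable M" and p: "projects f p"
    and I: "is_interval I" "AE x in M. f x \<in> I"
  shows "AE x in M. p x \<in> I"
proof -
  have psq: "p \<in> square_integrable M" using p square_integrable by (simp add: projects_def)
  note [measurable] = f psq
  have off: "AE x in M. p x \<notin> S"
    \<comment> \<open>The sign of \<open>c\<close> tells the side: c = 1 for values above I, c = -1
      for values below.\<close>
    if S: "is_interval S" and c: "c \<noteq> 0" and sep: "\<And>u v. u \<in> S \<Longrightarrow> v \<in> I \<Longrightarrow> 0 < c * (u - v)"
    for S and c :: real
  proof -
    have [measurable]: "S \<in> sets borel" using S by (rule real_interval_borel_measurable)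
    have sq: "(\<lambda>x. indicator S (p x) :: real) \<in> square_integrable M"
      by (intro square_integrable_bounded[of _ 1]) (auto simp: indicator_def)
    let ?d = "\<lambda>x. - c * (indicator S (p x) * (f x - p x))"
    have nn: "AE x in M. 0 \<le> ?d x"
      using I(2)
    proof eventually_elim
      fix x assume "f x \<in> I"
      then show "0 \<le> ?d x" using sep[of "p x" "f x"] by (auto simp: indicator_def algebra_simps)
    qed
    have "(LINT x|M. ?d x) = 0"
      using projects_orthogonal[OF f p _ sq] by simp
    moreover have "integrable M ?d"
      by (intro integrable_mult_right square_integrable_mult sq square_integrable_diff f psq)
    ultimately have "AE x in M. ?d x = 0"
      using integral_nonneg_eq_0_iff_AE nn by blast
    then show ?thesis
      using I(2)
    proof eventually_elim
      fix x assume "?d x = 0" "f x \<in> I"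
      then show "p x \<notin> S" using sep[of "p x" "f x"] c by (auto simp: indicator_def)
    qed
  qed
  have "AE x in M. p x \<notin> {u. \<forall>v\<in>I. v < u}"
    by (rule off[of _ 1]) (auto simp: is_interval_1 intro: less_le_trans)
  moreover have "AE x in M. p x \<notin> {u. \<forall>v\<in>I. u < v}"
    by (rule off[of _ "-1"]) (auto simp: is_interval_1 intro: le_less_trans)
  ultimately show ?thesis
  proof eventually_elim
    fix x assume "p x \<notin> {u. \<forall>v\<in>I. v < u}" "p x \<notin> {u. \<forall>v\<in>I. u < v}"
    then obtain u v where "u \<in> I" "v \<in> I" "u \<le> p x" "p x \<le> v" by (auto simp: not_less)
    then show "p x \<in> I" using I(1) unfolding is_interval_1 by blast
  qed
qed


end

subsection \<open>Selections of subgradients\<close>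

text \<open>The comparison with chord slopes says that \<phi>(u) is a subgradient of \<Phi> at u
  relative to I. At an end point of I one of the two comparisons is void, which leaves room for an
  infinite value.\<close>

locale subgradient_selection =
  fixes I :: "real set" and \<Phi> :: "real \<Rightarrow> real" and \<phi> :: "real \<Rightarrow> ereal"
  assumes interval: "is_interval I"
    and slope: "u \<in> I \<Longrightarrow> v \<in> I \<Longrightarrow> u < v \<Longrightarrow>
      \<phi> u \<le> ereal ((\<Phi> v - \<Phi> u) / (v - u)) \<and> ereal ((\<Phi> v - \<Phi> u) / (v - u)) \<le> \<phi> v"
begin

definition finite_dom :: "real set" where
  "finite_dom = {u \<in> I. \<bar>\<phi> u\<bar> \<noteq> \<infinity>}"

lemma selection_mono: "u \<in> I \<Longrightarrow> v \<in> I \<Longrightarrow> u \<le> v \<Longrightarrow> \<phi> u \<le> \<phi> v"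
  using slope[of u v] by (cases "u = v") auto

text \<open>A monotone function is finite between two points where it is finite. Being an interval,
  the set is Borel, which later yields a measurable version of \<phi>.\<close>

lemma is_interval_finite_dom: "is_interval finite_dom"
  unfolding is_interval_1
proof (intro ballI allI impI, elim conjE)
  fix u v t assume u: "u \<in> finite_dom" and v: "v \<in> finite_dom" and t: "u \<le> t" "t \<le> v"
  then have "t \<in> I" using interval unfolding is_interval_1 finite_dom_def by blast
  moreover from this have "\<phi> u \<le> \<phi> t" "\<phi> t \<le> \<phi> v"
    using selection_mono u v t by (auto simp: finite_dom_def)
  ultimately show "t \<in> finite_dom"
    using u v by (cases "\<phi> u"; cases "\<phi> t"; cases "\<phi> v") (auto simp: finite_dom_def)
qed

text \<open>Since \<open>real_of_ereal\<close> sends both infinities to 0, monotonicity of \<phi>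
  carries over only where \<phi> is finite.\<close>

lemma mono_on_finite_dom: "mono_on finite_dom (\<lambda>u. real_of_ereal (\<phi> u))"
proof (rule mono_onI)
  fix u v assume "u \<in> finite_dom" "v \<in> finite_dom" "u \<le> v"
  then show "real_of_ereal (\<phi> u) \<le> real_of_ereal (\<phi> v)"
    using selection_mono[of u v] by (cases "\<phi> u"; cases "\<phi> v") (auto simp: finite_dom_def)
qed

lemma bregman_finite:
  assumes "v \<in> finite_dom"
  shows "real_of_ereal (bregman \<Phi> \<phi> u v) = \<Phi> u - \<Phi> v - real_of_ereal (\<phi> v) * (u - v)"
  using assms by (cases "\<phi> v") (auto simp: bregman_def finite_dom_def)

lemma bregman_nonneg:
  assumes u: "u \<in> I" and v: "v \<in> finite_dom"
  shows "0 \<le> \<Phi> u - \<Phi> v - real_of_ereal (\<phi> v) * (u - v)"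
proof -
  obtain r where r: "\<phi> v = ereal r" using v by (cases "\<phi> v") (auto simp: finite_dom_def)
  have vI: "v \<in> I" using v by (simp add: finite_dom_def)
  consider "u = v" | "u < v" | "v < u" by linarith
  then show ?thesis
  proof cases
    case 2
    then show ?thesis using slope[OF u vI] r by (simp add: field_simps)
  next
    case 3
    then show ?thesis using slope[OF vI u] r by (simp add: field_simps)
  qed simp
qed

text \<open>If the supporting line at v met the graph again at u, strict convexity would push the
  graph below this line at the midpoint.\<close>

lemma bregman_zero_strict:
  assumes sc: "strictly_convex_on I \<Phi>" and u: "u \<in> I" and v: "v \<in> finite_dom"
    and z: "\<Phi> u - \<Phi> v - real_of_ereal (\<phi> v) * (u - v) = 0"
  shows "u = v"
proof (rule ccontr)
  assume "u \<noteq> v"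
  have vI: "v \<in> I" using v by (simp add: finite_dom_def)
  define m where "m = (1 - 1/2) * u + 1/2 * v"
  have lt: "0 < t \<Longrightarrow> t < 1 \<Longrightarrow> \<Phi> ((1 - t) * u + t * v) < (1 - t) * \<Phi> u + t * \<Phi> v" for t
    using sc u vI \<open>u \<noteq> v\<close> by (simp add: strictly_convex_on_def)
  have "convex I" using sc by (simp add: strictly_convex_on_def)
  then have "m \<in> I" using convexD[of I u v "1 - 1/2" "1/2"] u vI by (simp add: m_def)
  have "\<Phi> m < (1 - 1/2) * \<Phi> u + 1/2 * \<Phi> v"
    unfolding m_def by (rule lt) auto
  moreover have "0 \<le> \<Phi> m - \<Phi> v - real_of_ereal (\<phi> v) * (m - v)"
    using bregman_nonneg[OF \<open>m \<in> I\<close> v] .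
  moreover have "m - v = (u - v) / 2" by (simp add: m_def field_simps)
  ultimately show False using z by simp
qed

end

subsection \<open>Minimality of the projection for Bregman functionals\<close>

locale isotone_bregman = isotone_cone M K + subgradient_selection I \<Phi> \<phi>
  for M :: "'a measure" and K I \<Phi> \<phi> +
  fixes f p :: "'a \<Rightarrow> real"
  assumes f: "f \<in> square_integrable M" and f_range: "AE x in M. f x \<in> I"
    and p: "projects f p"
    and \<Phi>f: "integrable M (\<lambda>x. \<Phi> (f x))"
    and \<Phi>g: "g \<in> K \<Longrightarrow> AE x in M. g x \<in> I \<Longrightarrow> integrable M (\<lambda>x. \<Phi> (g x))"
    and \<phi>g: "g \<in> K \<Longrightarrow> AE x in M. g x \<in> I \<Longrightarrow>
      (AE x in M. \<bar>\<phi> (g x)\<bar> \<noteq> \<infinity>) \<and> (\<lambda>x. real_of_ereal (\<phi> (g x))) \<in> square_integrable M"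
begin

definition J :: "('a \<Rightarrow> real) \<Rightarrow> real" where
  "J g = (LINT x|M. \<Phi> (f x) - \<Phi> (g x) - real_of_ereal (\<phi> (g x)) * (f x - g x))"

text \<open>This is \<Delta>_\<Phi>(p x, g x) with \<phi> read as a real number; its integral bounds
  J g - J p from below.\<close>

definition excess :: "('a \<Rightarrow> real) \<Rightarrow> 'a \<Rightarrow> real" where
  "excess g x = \<Phi> (p x) - \<Phi> (g x) - real_of_ereal (\<phi> (g x)) * (p x - g x)"

lemma p_in: "p \<in> K" "AE x in M. p x \<in> I"
  using p projects_range[OF f p interval f_range] by (auto simp: projects_def)

lemma AE_finite_dom:
  assumes "g \<in> K" "AE x in M. g x \<in> I"
  shows "AE x in M. g x \<in> finite_dom"
  using conjunct1[OF \<phi>g[OF assms]] assms(2)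
  by eventually_elim (simp add: finite_dom_def)

lemma integrable_excess:
  assumes g: "g \<in> K" "AE x in M. g x \<in> I"
  shows "integrable M (excess g)"
  unfolding excess_def using \<Phi>g[OF p_in] \<Phi>g[OF g]
  by (intro Bochner_Integration.integrable_diff square_integrable_mult
      conjunct2[OF \<phi>g[OF g]] square_integrable_diff square_integrable p_in(1) g(1)) auto

lemma excess_nonneg:
  assumes g: "g \<in> K" "AE x in M. g x \<in> I"
  shows "AE x in M. 0 \<le> excess g x"
  using AE_finite_dom[OF g] p_in(2)
  by eventually_elim (simp only: excess_def bregman_nonneg)

lemma integrable_J:
  assumes g: "g \<in> K" "AE x in M. g x \<in> I"
  shows "integrable M (\<lambda>x. \<Phi> (f x) - \<Phi> (g x) - real_of_ereal (\<phi> (g x)) * (f x - g x))"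
  using \<Phi>f \<Phi>g[OF g]
  by (intro Bochner_Integration.integrable_diff square_integrable_mult
      conjunct2[OF \<phi>g[OF g]] square_integrable_diff square_integrable g(1) f) auto

lemma orthogonal_selection:
  "(LINT x|M. real_of_ereal (\<phi> (p x)) * (f x - p x)) = 0"
proof -
  note [measurable] = square_integrable[OF p_in(1)] f conjunct2[OF \<phi>g[OF p_in]]
  \<comment> \<open>Outside I nothing is known about \<phi>, so it may fail to be Borel. Cutting it
    off to an interval on which it is monotone gives a Borel function that agrees with \<phi> at
    almost all values of p.\<close>
  define \<theta> where "\<theta> u = indicator finite_dom u *\<^sub>R real_of_ereal (\<phi> u)" for u
  have "finite_dom \<in> sets borel"
    by (rule real_interval_borel_measurable[OF is_interval_finite_dom])
  then have [measurable]: "\<theta> \<in> borel_measurable borel"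
    using borel_measurable_mono_on_fnc[OF mono_on_finite_dom]
    unfolding \<theta>_def by (subst (asm) borel_measurable_restrict_space_iff) auto
  have eq: "AE x in M. real_of_ereal (\<phi> (p x)) = \<theta> (p x)"
    using AE_finite_dom[OF p_in] by eventually_elim (simp add: \<theta>_def)
  have "integrable M (\<lambda>x. (\<theta> (p x))\<^sup>2)"
    using square_integrable_square[OF conjunct2[OF \<phi>g[OF p_in]]]
  proof (rule integrable_cong_AE_imp)
    show "AE x in M. (real_of_ereal (\<phi> (p x)))\<^sup>2 = (\<theta> (p x))\<^sup>2"
      using eq by eventually_elim simp
  qed measurable
  then have sq: "(\<lambda>x. \<theta> (p x)) \<in> square_integrable M"
    by (simp add: square_integrable_def)
  have "(LINT x|M. real_of_ereal (\<phi> (p x)) * (f x - p x)) = (LINT x|M. \<theta> (p x) * (f x - p x))"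
    using eq by (intro integral_cong_AE) auto
  also have "\<dots> = 0" by (rule projects_orthogonal[OF f p _ sq]) measurable
  finally show ?thesis .
qed

text \<open>A three-point identity for \<Delta>_\<Phi> splits J g - J p into the excess and two
  pairings with the residual: the one with \<phi>(p) vanishes, the one with \<phi>(g) has a sign
  because \<phi>(g) lies in the cone.\<close>

lemma J_excess:
  assumes g: "g \<in> K" "AE x in M. g x \<in> I"
  shows "J p + (LINT x|M. excess g x) \<le> J g"
proof -
  let ?\<psi> = "\<lambda>u. real_of_ereal (\<phi> u)"
  have fp: "(\<lambda>x. f x - p x) \<in> square_integrable M"
    by (intro square_integrable_diff f square_integrable p_in(1))
  note int = square_integrable_mult[OF conjunct2[OF \<phi>g[OF g]] fp]
    square_integrable_mult[OF conjunct2[OF \<phi>g[OF p_in]] fp]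
  have "(\<lambda>x. ?\<psi> (g x)) \<in> K"
    using mono_comp[OF g(1) mono_on_finite_dom AE_finite_dom[OF g]] \<phi>g[OF g] by simp
  then have polar: "(LINT x|M. ?\<psi> (g x) * (f x - p x)) \<le> 0"
    by (rule projects_polar[OF f p])
  define B where "B x = \<Phi> (f x) - \<Phi> (p x) - ?\<psi> (p x) * (f x - p x)" for x
  have B: "integrable M B" unfolding B_def by (rule integrable_J[OF p_in])
  have "J g = (LINT x|M. B x + excess g x + (?\<psi> (p x) * (f x - p x) - ?\<psi> (g x) * (f x - p x)))"
    unfolding J_def
    by (intro Bochner_Integration.integral_cong) (auto simp: B_def excess_def algebra_simps)
  also have "\<dots> = (LINT x|M. B x) + (LINT x|M. excess g x)
      + ((LINT x|M. ?\<psi> (p x) * (f x - p x)) - (LINT x|M. ?\<psi> (g x) * (f x - p x)))"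
    using B integrable_excess[OF g] int by simp
  also have "(LINT x|M. B x) = J p" by (simp add: B_def J_def)
  finally show ?thesis using polar orthogonal_selection by simp
qed

lemma J_minimal:
  assumes g: "g \<in> K" "AE x in M. g x \<in> I"
  shows "J p \<le> J g"
  using J_excess[OF g] integral_nonneg_AE[OF excess_nonneg[OF g]] by simp

lemma J_minimal_unique:
  assumes g: "g \<in> K" "AE x in M. g x \<in> I" and le: "J g \<le> J p" and sc: "strictly_convex_on I \<Phi>"
  shows "AE x in M. g x = p x"
proof -
  have "(LINT x|M. excess g x) = 0"
    using J_excess[OF g] integral_nonneg_AE[OF excess_nonneg[OF g]] le by simp
  then have "AE x in M. excess g x = 0"
    using integral_nonneg_eq_0_iff_AE[OF integrable_excess[OF g] excess_nonneg[OF g]] by simp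
  then show ?thesis
    using AE_finite_dom[OF g] p_in(2)
    by eventually_elim (auto simp: excess_def dest: bregman_zero_strict[OF sc])
qed

end

subsection \<open>One-sided derivatives of convex functions\<close>

lemma slope_swap: "(\<Phi> u - \<Phi> v) / (u - v) = (\<Phi> v - \<Phi> u) / (v - u)" for u v :: real and \<Phi> :: "real \<Rightarrow> real"
  by (metis minus_diff_eq minus_divide_divide)

lemma ext_fun_quotient:
  assumes "u \<in> I" "z \<in> I" "z \<noteq> u"
  shows "(ext_fun I \<Phi> z - ext_fun I \<Phi> u) / ereal (z - u) = ereal ((\<Phi> z - \<Phi> u) / (z - u))"
  using assms by (simp add: ext_fun_def)

text \<open>\<open>left_deriv\<close> is a \<open>Lim\<close> and says something only once the limit
  exists. By convexity the quotients increase towards u, so they converge in \<open>ereal\<close>,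
  to a value above each of them.\<close>

lemma slope_le_left_deriv:
  assumes \<Phi>: "convex_on I \<Phi>" and uv: "u \<in> I" "v \<in> I" "v < u"
  shows "ereal ((\<Phi> u - \<Phi> v) / (u - v)) \<le> left_deriv I \<Phi> u"
proof -
  define q where "q z = ereal ((\<Phi> z - \<Phi> u) / (z - u))" for z
  have I: "z \<in> I" if "v \<le> z" "z \<le> u" for z
    using convex_on_imp_convex[OF \<Phi>] uv that by (metis is_interval_1 is_interval_convex_1)
  have mono: "q s \<le> q t" if "v \<le> s" "s \<le> t" "t < u" for s t
    using convex_on_slope_le(2)[OF \<Phi> I[of s] uv(1), of t] that by (cases "s = t") (auto simp: q_def)
  have "(q \<longlongrightarrow> Sup (q ` ({..<u} \<inter> {v<..}))) (at u within ({..<u} \<inter> {v<..}))"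
    by (rule Lim_left_bound[where K = \<infinity>]) (auto intro: mono)
  moreover have "at u within ({..<u} \<inter> {v<..}) = at_left u"
    using uv by (intro at_within_nhd[of u "{v<..}"]) auto
  ultimately obtain L where L: "(q \<longlongrightarrow> L) (at_left u)" by auto
  \<comment> \<open>As v lies in I, all points close to u on its left are in I too, where the
    extended quotient is the real one.\<close>
  have ev: "\<forall>\<^sub>F z in at_left u. z \<in> {v<..<u}"
    using uv(3) by (rule eventually_at_left_real)
  have "((\<lambda>z. (ext_fun I \<Phi> z - ext_fun I \<Phi> u) / ereal (z - u)) \<longlongrightarrow> L) (at_left u)"
    using L
  proof (rule Lim_transform_eventually)
    show "\<forall>\<^sub>F z in at_left u. q z = (ext_fun I \<Phi> z - ext_fun I \<Phi> u) / ereal (z - u)"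
      using ev by eventually_elim (use uv I in \<open>auto simp: ext_fun_quotient q_def\<close>)
  qed
  then have "left_deriv I \<Phi> u = L"
    unfolding left_deriv_def by (intro tendsto_Lim) auto
  moreover have "q v \<le> L"
  proof (rule tendsto_lowerbound[OF L])
    show "\<forall>\<^sub>F z in at_left u. q v \<le> q z"
      using ev by eventually_elim (auto intro: mono)
  qed simp
  ultimately show ?thesis by (simp add: q_def slope_swap[of \<Phi> v u])
qed

text \<open>Mirror image of \<open>slope_le_left_deriv\<close>: the quotients decrease towards u and
  converge to a lower bound.\<close>

lemma right_deriv_le_slope:
  assumes \<Phi>: "convex_on I \<Phi>" and uv: "u \<in> I" "v \<in> I" "u < v"
  shows "right_deriv I \<Phi> u \<le> ereal ((\<Phi> v - \<Phi> u) / (v - u))"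
proof -
  define q where "q z = ereal ((\<Phi> z - \<Phi> u) / (z - u))" for z
  have I: "z \<in> I" if "u \<le> z" "z \<le> v" for z
    using convex_on_imp_convex[OF \<Phi>] uv that by (metis is_interval_1 is_interval_convex_1)
  have mono: "q s \<le> q t" if "u < s" "s \<le> t" "t \<le> v" for s t
    using convex_on_slope_le(1)[OF \<Phi> uv(1) I[of t], of s] that
    by (cases "s = t") (auto simp: q_def slope_swap[of \<Phi> u])
  have "(q \<longlongrightarrow> Inf (q ` ({u<..} \<inter> {..<v}))) (at u within ({u<..} \<inter> {..<v}))"
    by (rule Lim_right_bound[where K = "-\<infinity>"]) (auto intro: mono)
  moreover have "at u within ({u<..} \<inter> {..<v}) = at_right u"
    using uv by (intro at_within_nhd[of u "{..<v}"]) auto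
  ultimately obtain L where L: "(q \<longlongrightarrow> L) (at_right u)" by auto
  have ev: "\<forall>\<^sub>F z in at_right u. z \<in> {u<..<v}"
    using uv(3) by (rule eventually_at_right_real)
  have "((\<lambda>z. (ext_fun I \<Phi> z - ext_fun I \<Phi> u) / ereal (z - u)) \<longlongrightarrow> L) (at_right u)"
    using L
  proof (rule Lim_transform_eventually)
    show "\<forall>\<^sub>F z in at_right u. q z = (ext_fun I \<Phi> z - ext_fun I \<Phi> u) / ereal (z - u)"
      using ev by eventually_elim (use uv I in \<open>auto simp: ext_fun_quotient q_def\<close>)
  qed
  then have "right_deriv I \<Phi> u = L"
    unfolding right_deriv_def by (intro tendsto_Lim) auto
  moreover have "L \<le> q v"
  proof (rule tendsto_upperbound[OF L])
    show "\<forall>\<^sub>F z in at_right u. q z \<le> q v"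
      using ev by eventually_elim (auto intro: mono)
  qed simp
  ultimately show ?thesis by (simp add: q_def)
qed

lemma subgradient_selectionI:
  assumes "is_interval I" "convex_on I \<Phi>"
    and "\<And>u. u \<in> I \<Longrightarrow> left_deriv I \<Phi> u \<le> \<phi> u \<and> \<phi> u \<le> right_deriv I \<Phi> u"
  shows "subgradient_selection I \<Phi> \<phi>"
proof
  fix u v assume "u \<in> I" "v \<in> I" "u < v"
  then show "\<phi> u \<le> ereal ((\<Phi> v - \<Phi> u) / (v - u)) \<and> ereal ((\<Phi> v - \<Phi> u) / (v - u)) \<le> \<phi> v"
    using assms(3) right_deriv_le_slope[OF assms(2), of u v] slope_le_left_deriv[OF assms(2), of v u]
    by (meson order_trans)
qed fact

section \<open>Bounds for the weights\<close>

lemma S_inf_pos_bounds: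
  assumes "w \<in> S_inf_pos a b"
  obtains c C where "w \<in> borel_measurable (lebesgue_on (cbox a b))" "0 < c"
    "AE x in lebesgue_on (cbox a b). c \<le> w x \<and> w x \<le> C"
proof -
  let ?N = "lebesgue_on (cbox a b)"
  from assms obtain c where c: "0 < c" and w: "w \<in> Linf (cbox a b)"
    and approx: "\<And>\<epsilon>. 0 < \<epsilon> \<Longrightarrow>
      \<exists>s\<in>dyadic_step a b {c..}. Linf_norm (cbox a b) (\<lambda>x. w x - s x) < ereal \<epsilon>"
    unfolding S_inf_pos_def Linf_closure_def by auto
  obtain C where C: "Linf_norm (cbox a b) w \<le> ereal C"
    using w unfolding Linf_def by (cases "Linf_norm (cbox a b) w") auto
  \<comment> \<open>Within c/2 of a step function that is at least c, the weight is at least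
    c/2.\<close>
  obtain s where s: "s \<in> dyadic_step a b {c..}"
    and lt: "Linf_norm (cbox a b) (\<lambda>x. w x - s x) < ereal (c / 2)"
    using approx[of "c / 2"] c by auto
  \<comment> \<open>A non-measurable function has \<open>esssup\<close> equal to \<open>\<infinity>\<close>, so no measurability of \<open>s\<close> is needed.\<close>
  have "AE x in ?N. c / 2 \<le> w x \<and> w x \<le> C"
    using esssup_AE[where M = ?N and f = "\<lambda>x. ereal \<bar>w x - s x\<bar>"]
      esssup_AE[where M = ?N and f = "\<lambda>x. ereal \<bar>w x\<bar>"] AE_space
  proof eventually_elim
    fix x assume 1: "ereal \<bar>w x - s x\<bar> \<le> esssup ?N (\<lambda>x. ereal \<bar>w x - s x\<bar>)"
      and 2: "ereal \<bar>w x\<bar> \<le> esssup ?N (\<lambda>x. ereal \<bar>w x\<bar>)" and x: "x \<in> space ?N"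
    have "ereal \<bar>w x - s x\<bar> < ereal (c / 2)"
      using 1 lt unfolding Linf_norm_def by (rule le_less_trans)
    moreover have "ereal \<bar>w x\<bar> \<le> ereal C"
      using 2 C unfolding Linf_norm_def by (rule order_trans)
    moreover have "c \<le> s x" using s x by (auto simp: dyadic_step_def)
    ultimately show "c / 2 \<le> w x \<and> w x \<le> C" by (auto simp: abs_if split: if_splits)
  qed
  then show ?thesis using that[of "c / 2" C] c w by (simp add: Linf_def)
qed

subsection \<open>Weighted Lebesgue measure and \<open>\<sigma>\<close>-monotonic functions\<close>

text \<open>The weight is absorbed into the measure, so that the abstract results apply to the
  weighted problem. The two-sided bounds preserve null sets and square integrability.\<close>

locale bounded_weight =
  fixes N :: "'a measure" and w :: "'a \<Rightarrow> real" and c C :: real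
  assumes weight_measurable [measurable]: "w \<in> borel_measurable N"
    and c_pos: "0 < c" and weight_bounds: "AE x in N. c \<le> w x \<and> w x \<le> C"
begin

abbreviation weighted :: "'a measure" where
  "weighted \<equiv> density N (\<lambda>x. ennreal (w x))"

lemma AE_weighted_iff: "(AE x in weighted. P x) \<longleftrightarrow> (AE x in N. P x)"
proof -
  have "AE x in N. 0 < w x"
    using weight_bounds c_pos by (auto elim: eventually_mono)
  then show ?thesis
    by (subst AE_density) (auto elim: eventually_elim2)
qed

lemma weight_nonneg: "AE x in N. 0 \<le> w x"
  using weight_bounds c_pos by (auto elim: eventually_mono)

lemma integral_weighted:
  "g \<in> borel_measurable N \<Longrightarrow> integral\<^sup>L weighted g = (LINT x|N. g x * w x)"
  by (subst integral_density) (auto simp: weight_nonneg mult.commute)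

lemma integrable_weighted_iff: "integrable weighted g \<longleftrightarrow> integrable N g" for g :: "'a \<Rightarrow> real"
proof (cases "g \<in> borel_measurable N")
  case [measurable]: True
  have "integrable weighted g \<longleftrightarrow> integrable N (\<lambda>x. w x * g x)"
    using integrable_density[OF True weight_measurable weight_nonneg] by simp
  also have "\<dots> \<longleftrightarrow> integrable N g"
  proof
    assume "integrable N (\<lambda>x. w x * g x)"
    then have "integrable N (\<lambda>x. (1 / c) * (w x * g x))" by (rule integrable_mult_right)
    then show "integrable N g"
    proof (rule Bochner_Integration.integrable_bound)
      show "AE x in N. norm (g x) \<le> norm ((1 / c) * (w x * g x))"
        using weight_bounds
      proof eventually_elim
        fix x assume "c \<le> w x \<and> w x \<le> C"
        then have "c * \<bar>g x\<bar> \<le> w x * \<bar>g x\<bar>" and "0 < w x"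
          using c_pos by (auto intro: mult_right_mono)
        then show "norm (g x) \<le> norm ((1 / c) * (w x * g x))"
          using c_pos by (simp add: abs_mult field_simps)
      qed
    qed measurable
  next
    assume "integrable N g"
    then have "integrable N (\<lambda>x. C * g x)" by (rule integrable_mult_right)
    then show "integrable N (\<lambda>x. w x * g x)"
    proof (rule Bochner_Integration.integrable_bound)
      show "AE x in N. norm (w x * g x) \<le> norm (C * g x)"
        using weight_bounds
      proof eventually_elim
        fix x assume "c \<le> w x \<and> w x \<le> C"
        then have "\<bar>w x\<bar> \<le> \<bar>C\<bar>" using c_pos by auto
        then show "norm (w x * g x) \<le> norm (C * g x)"
          by (simp add: abs_mult mult_right_mono)
      qed
    qed measurable
  qed
  finally show ?thesis .
next
  case False
  then show ?thesis by (auto dest!: borel_measurable_integrable)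
qed

lemma square_integrable_weighted: "square_integrable weighted = square_integrable N"
  by (simp add: square_integrable_def integrable_weighted_iff)

text \<open>The axioms of the cone see the measure only through finiteness, null sets and square
  integrability, which a bounded weight does not change.\<close>

lemma isotone_cone_weighted:
  assumes "isotone_cone N K"
  shows "isotone_cone weighted K"
proof -
  interpret isotone_cone N K by fact
  have "integrable weighted (\<lambda>_. 1 :: real)"
    by (simp add: integrable_weighted_iff)
  then have "finite_measure weighted"
    by (intro finite_measureI) (simp add: integrable_iff_bounded less_top)
  then interpret weighted: finite_measure weighted .
  show ?thesis
  proof (unfold_locales, unfold square_integrable_weighted AE_weighted_iff)
  qed (fact square_integrable zero add scale mono_comp AE_limit)+
qed

end

section \<open>Lebesgue null sets and the cone of \<sigma>-monotonic functions\<close>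

lemma AE_lebesgue_onE:
  assumes "AE x in lebesgue_on Q. P x" "Q \<in> sets lebesgue"
  obtains N where "N \<in> null_sets lebesgue" "\<And>x. x \<in> Q - N \<Longrightarrow> P x"
proof -
  from assms(1) obtain N where "N \<in> null_sets (lebesgue_on Q)" "{x \<in> space (lebesgue_on Q). \<not> P x} \<subseteq> N"
    by (auto simp: eventually_ae_filter)
  then show ?thesis using that[of N] assms(2) by (auto simp: null_sets_restrict_space)
qed

text \<open>Completeness of Lebesgue measure. It makes the Bregman integrand measurable, which is
  known explicitly only almost everywhere.\<close>

lemma borel_measurable_lebesgue_on_AE:
  fixes g h :: "'a::euclidean_space \<Rightarrow> real"
  assumes g: "g \<in> borel_measurable (lebesgue_on Q)" and eq: "AE x in lebesgue_on Q. g x = h x"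
    and Q: "Q \<in> sets lebesgue"
  shows "h \<in> borel_measurable (lebesgue_on Q)"
proof -
  have "(\<lambda>x. indicator Q x *\<^sub>R g x) \<in> borel_measurable lebesgue"
    using g Q by (simp add: borel_measurable_restrict_space_iff)
  moreover have "AE x in lebesgue. x \<in> Q \<longrightarrow> g x = h x"
    using eq Q by (simp add: AE_restrict_space_iff)
  then have "AE x in lebesgue. indicator Q x *\<^sub>R g x = indicator Q x *\<^sub>R h x"
    by eventually_elim (auto simp: indicator_def)
  ultimately have "(\<lambda>x. indicator Q x *\<^sub>R h x) \<in> borel_measurable lebesgue"
    by (rule borel_measurable_AE)
  then show ?thesis using Q by (simp add: borel_measurable_restrict_space_iff)
qed

lemma L2_eq_square_integrable: "L2 Q = square_integrable (lebesgue_on Q)"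
  by (simp add: L2_def square_integrable_def)

lemma L2_sigma_UNIV_iff:
  "g \<in> L2_sigma \<sigma> Q UNIV \<longleftrightarrow>
    g \<in> square_integrable (lebesgue_on Q) \<and> (\<exists>N \<in> null_sets lebesgue. sigma_mono_on \<sigma> (Q - N) g)"
  by (simp add: L2_sigma_def L2_eq_square_integrable)

lemma L2_sigma_iff:
  "g \<in> L2_sigma \<sigma> Q I \<longleftrightarrow> g \<in> L2_sigma \<sigma> Q UNIV \<and> (AE x in lebesgue_on Q. g x \<in> I)"
  by (auto simp: L2_sigma_def)

text \<open>Each closure property holds pointwise off the union of the exceptional null sets
  involved; for limits this union is countable.\<close>

lemma isotone_cone_L2_sigma:
  assumes Q: "Q \<in> lmeasurable"
  shows "isotone_cone (lebesgue_on Q) (L2_sigma \<sigma> Q UNIV)"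
proof -
  let ?N = "lebesgue_on Q" and ?K = "L2_sigma \<sigma> Q UNIV"
  have Qs: "Q \<in> sets lebesgue" using Q by (rule fmeasurableD)
  interpret finite_measure ?N
    using Q by (rule finite_measure_lebesgue_on)
  show ?thesis
  proof
    show "g \<in> square_integrable ?N" if "g \<in> ?K" for g
      using that by (simp add: L2_sigma_UNIV_iff)
    show "(\<lambda>_. 0) \<in> ?K"
      using square_integrable_const by (auto simp: L2_sigma_UNIV_iff sigma_mono_on_def)
    show "(\<lambda>x. g x + h x) \<in> ?K" if gh: "g \<in> ?K" "h \<in> ?K" for g h
    proof -
      obtain N1 N2 where "N1 \<in> null_sets lebesgue" "N2 \<in> null_sets lebesgue"
        and m: "sigma_mono_on \<sigma> (Q - N1) g" "sigma_mono_on \<sigma> (Q - N2) h"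
        using gh unfolding L2_sigma_UNIV_iff by blast
      then have "N1 \<union> N2 \<in> null_sets lebesgue" by auto
      moreover have "sigma_mono_on \<sigma> (Q - (N1 \<union> N2)) (\<lambda>x. g x + h x)"
        using m by (auto simp: sigma_mono_on_def intro!: add_mono)
      ultimately show ?thesis
        using gh by (auto simp: L2_sigma_UNIV_iff intro: square_integrable_add)
    qed
    show "(\<lambda>x. r * g x) \<in> ?K" if "g \<in> ?K" "0 \<le> r" for g r
      using that by (auto simp: L2_sigma_UNIV_iff sigma_mono_on_def
          intro!: square_integrable_cmult mult_left_mono)
    show "(\<lambda>x. \<theta> (g x)) \<in> ?K"
      if g: "g \<in> ?K" and \<theta>: "mono_on A \<theta>" and A: "AE x in ?N. g x \<in> A"
        and sq: "(\<lambda>x. \<theta> (g x)) \<in> square_integrable ?N" for g A \<theta>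
    proof -
      obtain N1 where N1: "N1 \<in> null_sets lebesgue" and m: "sigma_mono_on \<sigma> (Q - N1) g"
        using g unfolding L2_sigma_UNIV_iff by blast
      obtain N2 where N2: "N2 \<in> null_sets lebesgue" "\<And>x. x \<in> Q - N2 \<Longrightarrow> g x \<in> A"
        using AE_lebesgue_onE[OF A Qs] by blast
      have "N1 \<union> N2 \<in> null_sets lebesgue" using N1 N2 by auto
      moreover have "sigma_mono_on \<sigma> (Q - (N1 \<union> N2)) (\<lambda>x. \<theta> (g x))"
        using m N2(2) by (auto simp: sigma_mono_on_def intro!: mono_onD[OF \<theta>])
      ultimately show ?thesis using sq by (auto simp: L2_sigma_UNIV_iff)
    qed
    show "g \<in> ?K"
      if H: "\<And>n. H n \<in> ?K" and lim: "AE x in ?N. (\<lambda>n. H n x) \<longlonglongrightarrow> g x"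
        and sq: "g \<in> square_integrable ?N" for H :: "nat \<Rightarrow> _" and g
    proof -
      obtain N where N: "\<And>n. N n \<in> null_sets lebesgue" and m: "\<And>n. sigma_mono_on \<sigma> (Q - N n) (H n)"
        using H unfolding L2_sigma_UNIV_iff by metis
      obtain N' where N': "N' \<in> null_sets lebesgue" "\<And>x. x \<in> Q - N' \<Longrightarrow> (\<lambda>n. H n x) \<longlonglongrightarrow> g x"
        using AE_lebesgue_onE[OF lim Qs] by blast
      have "(\<Union>n. N n) \<union> N' \<in> null_sets lebesgue" using N N' by auto
      moreover have "sigma_mono_on \<sigma> (Q - ((\<Union>n. N n) \<union> N')) g"
        unfolding sigma_mono_on_def
      proof (intro ballI impI)
        fix x y assume xy: "x \<in> Q - ((\<Union>n. N n) \<union> N')" "y \<in> Q - ((\<Union>n. N n) \<union> N')" "sigma_le \<sigma> x y"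
        then have "H n x \<le> H n y" for n using m[of n] by (auto simp: sigma_mono_on_def)
        then show "g x \<le> g y" using xy by (intro LIMSEQ_le[OF N'(2) N'(2)]) auto
      qed
      ultimately show ?thesis using sq by (auto simp: L2_sigma_UNIV_iff)
    qed
  qed
qed

text \<open>\<open>arg_min_on\<close> is a choice and yields a minimizer as soon as one
  exists.\<close>

lemma is_arg_min_arg_min_on:
  assumes "x \<in> S" "\<And>y. y \<in> S \<Longrightarrow> f x \<le> (f y :: 'b :: linorder)"
  shows "is_arg_min f (\<lambda>y. y \<in> S) (arg_min_on f S)"
  unfolding arg_min_on_def arg_min_def
  by (rule someI[of _ x]) (use assms in \<open>auto simp: is_arg_min_def not_less\<close>)

theorem theorem5p4:
  fixes a b \<sigma> :: "real^'n"
    and f w :: "real^'n \<Rightarrow> real"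
    and I :: "real set" and \<Phi> :: "real \<Rightarrow> real" and \<phi> :: "real \<Rightarrow> ereal"
  defines "Q \<equiv> cbox a b"
  defines "fstar \<equiv> sigma_proj \<sigma> Q w f"
  assumes "\<And>i. a $ i < b $ i"
    and "\<And>i. \<sigma> $ i \<in> {-1, 0, 1}"
    and "f \<in> L2 Q"
    and "w \<in> S_inf_pos a b"
    and "is_interval I"
    and "convex_on I \<Phi>"
    and "\<And>u. u \<in> I \<Longrightarrow> left_deriv I \<Phi> u \<le> \<phi> u \<and> \<phi> u \<le> right_deriv I \<Phi> u"
    and "\<exists>f0. (AE x in lebesgue_on Q. f0 x = f x) \<and> f0 ` Q \<subseteq> I"
    and "integrable (lebesgue_on Q) (\<lambda>x. \<Phi> (f x))"
    and "\<And>g. g \<in> L2_sigma \<sigma> Q I \<Longrightarrow> integrable (lebesgue_on Q) (\<lambda>x. \<Phi> (g x))"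
    and "\<And>g. g \<in> L2_sigma \<sigma> Q I \<Longrightarrow>
           (AE x in lebesgue_on Q. \<bar>\<phi> (g x)\<bar> \<noteq> \<infinity>) \<and> (\<lambda>x. real_of_ereal (\<phi> (g x))) \<in> L2 Q"
  shows "is_arg_min (bregman_functional \<Phi> \<phi> Q f w) (\<lambda>g. g \<in> L2_sigma \<sigma> Q I) fstar \<and>
         (strictly_convex_on I \<Phi> \<longrightarrow>
           (\<forall>g. is_arg_min (bregman_functional \<Phi> \<phi> Q f w) (\<lambda>g. g \<in> L2_sigma \<sigma> Q I) g \<longrightarrow>
             (AE x in lebesgue_on Q. g x = fstar x)))"
proof -
  let ?N = "lebesgue_on Q" and ?K = "L2_sigma \<sigma> Q UNIV"
  note f = \<open>f \<in> L2 Q\<close>[unfolded L2_eq_square_integrable]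
  have Q: "Q \<in> lmeasurable" "Q \<in> sets lebesgue" by (auto simp: Q_def)
  obtain c C where "w \<in> borel_measurable ?N" "0 < c" "AE x in ?N. c \<le> w x \<and> w x \<le> C"
    using S_inf_pos_bounds[OF \<open>w \<in> S_inf_pos a b\<close>] unfolding Q_def by blast
  then interpret bounded_weight ?N w c C by unfold_locales
  interpret subgradient_selection I \<Phi> \<phi>
    using assms by (intro subgradient_selectionI) auto
  interpret isotone_cone weighted ?K
    by (intro isotone_cone_weighted isotone_cone_L2_sigma Q)
  have dist_eq: "(LINT x|?N. \<bar>f x - h x\<bar>\<^sup>2 * w x) = (LINT x|weighted. (f x - h x)\<^sup>2)"
    if "h \<in> ?K" for h
  proof -
    have "(\<lambda>x. f x - h x) \<in> square_integrable ?N"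
      using that f by (auto intro: square_integrable_diff simp: L2_sigma_UNIV_iff)
    then have [measurable]: "(\<lambda>x. f x - h x) \<in> borel_measurable ?N" by measurable
    show ?thesis by (subst integral_weighted) auto
  qed
  \<comment> \<open>The existence of some projection turns the choice hidden in
    \<open>sigma_proj\<close> into a genuine one.\<close>
  have proj: "projects f fstar"
  proof -
    obtain p where p: "p \<in> ?K"
      "\<And>h. h \<in> ?K \<Longrightarrow> (LINT x|weighted. (f x - p x)\<^sup>2) \<le> (LINT x|weighted. (f x - h x)\<^sup>2)"
      using projection_exists[of f] f by (auto simp: square_integrable_weighted)
    have "is_arg_min (\<lambda>h. LINT x|?N. \<bar>f x - h x\<bar>\<^sup>2 * w x) (\<lambda>h. h \<in> ?K) fstar"
      unfolding fstar_def sigma_proj_def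
      using p by (intro is_arg_min_arg_min_on[of p]) (simp_all only: dist_eq)
    then show ?thesis
      unfolding projects_def by (auto simp: is_arg_min_def not_less simp flip: dist_eq)
  qed
  have f_I: "AE x in ?N. f x \<in> I"
  proof -
    obtain f0 where f0: "AE x in ?N. f0 x = f x" "f0 ` Q \<subseteq> I"
      using assms(10) by blast
    show ?thesis using f0(1) AE_space
      by eventually_elim (use f0(2) in auto)
  qed
  have L2I: "g \<in> L2_sigma \<sigma> Q I \<longleftrightarrow> g \<in> ?K \<and> (AE x in weighted. g x \<in> I)" for g
    using L2_sigma_iff AE_weighted_iff by blast
  interpret isotone_bregman weighted ?K I \<Phi> \<phi> f fstar
    using f f_I proj assms(11-13) L2I
    by unfold_locales
      (auto simp: square_integrable_weighted AE_weighted_iff integrable_weighted_iff L2_eq_square_integrable)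
  \<comment> \<open>The integrands agree wherever \<phi>(g) is finite, that is, almost
    everywhere.\<close>
  have J_eq: "bregman_functional \<Phi> \<phi> Q f w g = J g" if g: "g \<in> L2_sigma \<sigma> Q I" for g
  proof -
    have gK: "g \<in> ?K" "AE x in weighted. g x \<in> I" using g L2I by auto
    let ?d = "\<lambda>x. \<Phi> (f x) - \<Phi> (g x) - real_of_ereal (\<phi> (g x)) * (f x - g x)"
    have d [measurable]: "?d \<in> borel_measurable ?N"
      using integrable_J[OF gK] by (auto simp: integrable_weighted_iff)
    have eq: "AE x in ?N. ?d x = real_of_ereal (bregman \<Phi> \<phi> (f x) (g x))"
      using AE_finite_dom[OF gK] unfolding AE_weighted_iff
      by eventually_elim (simp add: bregman_finite)
    have [measurable]: "(\<lambda>x. real_of_ereal (bregman \<Phi> \<phi> (f x) (g x))) \<in> borel_measurable ?N"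
      using borel_measurable_lebesgue_on_AE[OF d eq Q(2)] .
    have "bregman_functional \<Phi> \<phi> Q f w g = (LINT x|?N. ?d x * w x)"
      unfolding bregman_functional_def
    proof (rule integral_cong_AE)
      show "AE x in ?N. real_of_ereal (bregman \<Phi> \<phi> (f x) (g x)) * w x = ?d x * w x"
        using eq by eventually_elim simp
    qed measurable
    then show ?thesis unfolding J_def by (simp only: integral_weighted[OF d])
  qed
  \<comment> \<open>The projection is taken over all real-valued \<sigma>-monotonic functions; that
    it takes its values in I comes from \<open>projects_range\<close>.\<close>
  have fstar: "fstar \<in> L2_sigma \<sigma> Q I" using p_in L2I by blast
  show ?thesis
  proof (intro conjI impI allI)
    show "is_arg_min (bregman_functional \<Phi> \<phi> Q f w) (\<lambda>g. g \<in> L2_sigma \<sigma> Q I) fstar"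
      using fstar J_minimal by (auto simp: is_arg_min_def J_eq not_less L2I)
    fix g
    assume sc: "strictly_convex_on I \<Phi>"
      and "is_arg_min (bregman_functional \<Phi> \<phi> Q f w) (\<lambda>g. g \<in> L2_sigma \<sigma> Q I) g"
    then have g: "g \<in> L2_sigma \<sigma> Q I" and "J g \<le> J fstar"
      using fstar by (auto simp: is_arg_min_def J_eq not_less)
    then have "AE x in weighted. g x = fstar x"
      using J_minimal_unique[OF _ _ _ sc, of g] L2I by blast
    then show "AE x in ?N. g x = fstar x" by (simp add: AE_weighted_iff)
  qed
qed

end
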